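(* Let $\alpha,\beta$ be arbitrary non-negative real numbers and let $$\sigma=\begin{bmatrix}1&0\\0&-1\end{bmatrix},\qquad \tau=\begin{bmatrix}0&1\\1&0\end{bmatrix}.$$ Then the function $f_{\alpha\sigma,\beta\tau}(t)=\operatorname{trace}\, e^{t\alpha\sigma+\beta\tau}$ of the variable $t\in\mathbb{R}$ is exponentially convex.
   Context: A function $f:\mathbb{R}\to[0,\infty)$ is called exponentially convex if (1) for every nonnegative integer $N$, all real numbers $t_1,\dots,t_N$ and all complex numbers $\xi_1,\dots,\xi_N$ one has $\sum_{r,s=1}^{N} f(t_r+t_s)\,\xi_r\overline{\xi_s}\ge 0$; and (2) $f$ is continuous on $\mathbb{R}$. Here $e^{X}$ denotes the matrix exponential. *)

theory Defs
  imports "HOL-Analysis.Analysis"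
begin

definition exponentially_convex :: "(real \<Rightarrow> real) \<Rightarrow> bool" where
  "exponentially_convex f \<longleftrightarrow>
     (\<forall>x. f x \<ge> 0) \<and>
     (\<forall>(N::nat) (t :: nat \<Rightarrow> real) (\<xi> :: nat \<Rightarrow> complex).
        (\<Sum>r=1..N. \<Sum>s=1..N. complex_of_real (f (t r + t s)) * \<xi> r * cnj (\<xi> s)) \<in> \<real>\<^sub>\<ge>\<^sub>0) \<and>
     continuous_on UNIV f"

(* The powers are taken with respect to **, since the class operations * and ^ act
   entrywise on matrices of type real^'n^'n; for the same reason the library function exp
   is not available at this type. *)
primrec matpow :: "real^'n^'n \<Rightarrow> nat \<Rightarrow> real^'n^'n" where
  "matpow A 0 = mat 1"
| "matpow A (Suc k) = A ** matpow A k"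

definition mat_exp :: "real^'n^'n \<Rightarrow> real^'n^'n" where
  "mat_exp A = (\<Sum>k. (1 / fact k) *\<^sub>R matpow A k)"

(* suminf is unspecified on divergent series, but the exponential series always converges. *)
lemma summable_mat_exp:
  fixes A :: "real^'n^'n"
  shows "summable (\<lambda>k. (1 / fact k) *\<^sub>R matpow A k)"
proof -
  have "bilinear ((**) :: real^'n^'n \<Rightarrow> real^'n^'n \<Rightarrow> real^'n^'n)"
    by (auto simp: bilinear_def intro!: linearI
        simp: matrix_matrix_mult_def vec_eq_iff algebra_simps sum.distrib sum_distrib_left)
  then have "bounded_bilinear ((**) :: real^'n^'n \<Rightarrow> real^'n^'n \<Rightarrow> real^'n^'n)"
    by (simp add: bilinear_conv_bounded_bilinear)
  from bounded_bilinear.pos_bounded[OF this]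
  obtain K where K: "\<And>(A :: real^'n^'n) (B :: real^'n^'n). norm (A ** B) \<le> norm A * norm B * K" "K > 0"
    by blast
  define a where "a = norm A * K"
  have a: "a \<ge> 0"
    using K by (simp add: a_def)
  have bd: "norm (matpow A k) \<le> a ^ k * norm (mat 1 :: real^'n^'n)" for k
  proof (induction k)
    case (Suc k)
    have "norm (matpow A (Suc k)) \<le> a * norm (matpow A k)"
      using K(1)[of A "matpow A k"] by (simp add: a_def mult_ac)
    also have "\<dots> \<le> a * (a ^ k * norm (mat 1 :: real^'n^'n))"
      using Suc a by (rule mult_left_mono)
    finally show ?case
      by (simp add: mult_ac)
  qed simp
  have "summable (\<lambda>k. inverse (fact k) * a ^ k * norm (mat 1 :: real^'n^'n))"
    by (intro summable_mult2 summable_exp)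
  then show ?thesis
  proof (rule summable_comparison_test')
    fix k
    show "norm ((1 / fact k) *\<^sub>R matpow A k) \<le> inverse (fact k) * a ^ k * norm (mat 1 :: real^'n^'n)"
      using bd[of k] by (simp add: field_simps)
  qed
qed

definition trace_exp :: "real^'n^'n \<Rightarrow> real^'n^'n \<Rightarrow> real \<Rightarrow> real" where
  "trace_exp A B t = trace (mat_exp (t *\<^sub>R A + B))"

(* The argument of vector is the list of rows. *)
definition \<sigma> :: "real^2^2" where
  "\<sigma> = vector [vector [1, 0], vector [0, -1]]"

definition \<tau> :: "real^2^2" where
  "\<tau> = vector [vector [0, 1], vector [1, 0]]"

end

theory Submission
  imports Defs "HOL-Real_Asymp.Real_Asymp"
begin

text \<open>
  By the Lie--Trotter idea the trace is the limit of the traces of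
  \<open>(e\<^bsup>t\<alpha>\<sigma>/n\<^esup> (1 + \<beta>\<tau>/n))\<^bsup>n\<^esup>\<close>.  Since \<open>\<sigma>\<close> is diagonal and \<open>\<tau>\<close> has nonnegative entries,
  expanding the product shows that every entry of this power is a combination of exponentials
  \<open>e\<^bsup>kt\<^esup>\<close> with nonnegative coefficients.  Such functions have positive
  semidefinite kernels, and this property survives pointwise limits.  For \<open>2 \<times> 2\<close> matrices the
  convergence is read off the eigenvalues, so that no general Trotter formula is required.
\<close>

text \<open>Isolated from continuity because this condition passes to pointwise limits, while
  continuity in general does not.\<close>

definition psd_sum_kernel :: "(real \<Rightarrow> real) \<Rightarrow> bool" where
  "psd_sum_kernel f \<longleftrightarrow> (\<forall>(N::nat) (t :: nat \<Rightarrow> real) (\<xi> :: nat \<Rightarrow> complex).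
     (\<Sum>r=1..N. \<Sum>s=1..N. complex_of_real (f (t r + t s)) * \<xi> r * cnj (\<xi> s)) \<in> \<real>\<^sub>\<ge>\<^sub>0)"

text \<open>The double sum factors as \<open>c\<close> times the squared modulus of the sum of the
  \<open>\<xi> r\<close>.\<close>

lemma psd_sum_kernel_const:
  assumes "0 \<le> c"
  shows "psd_sum_kernel (\<lambda>_. c)"
  unfolding psd_sum_kernel_def
proof (intro allI)
  fix N :: nat and t :: "nat \<Rightarrow> real" and \<xi> :: "nat \<Rightarrow> complex"
  have "(\<Sum>r=1..N. \<Sum>s=1..N. complex_of_real c * \<xi> r * cnj (\<xi> s))
      = complex_of_real c * ((\<Sum>r=1..N. \<xi> r) * (\<Sum>s=1..N. cnj (\<xi> s)))"
    unfolding sum_product by (simp add: sum_distrib_left mult.assoc)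
  also have "\<dots> = complex_of_real (c * (cmod (\<Sum>r=1..N. \<xi> r))\<^sup>2)"
    by (simp only: of_real_mult complex_norm_square cnj_sum)
  also have "\<dots> \<in> \<real>\<^sub>\<ge>\<^sub>0"
    using assms by (simp only: nonneg_Reals_of_real_iff) simp
  finally show "(\<Sum>r=1..N. \<Sum>s=1..N. complex_of_real c * \<xi> r * cnj (\<xi> s)) \<in> \<real>\<^sub>\<ge>\<^sub>0" .
qed

lemma psd_sum_kernel_add:
  assumes "psd_sum_kernel f" "psd_sum_kernel g"
  shows "psd_sum_kernel (\<lambda>t. f t + g t)"
  using assms unfolding psd_sum_kernel_def
  by (simp add: distrib_right sum.distrib)

lemma psd_sum_kernel_sum:
  assumes "\<And>i. i \<in> I \<Longrightarrow> psd_sum_kernel (f i)"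
  shows "psd_sum_kernel (\<lambda>t. \<Sum>i\<in>I. f i t)"
  using assms
  by (induction I rule: infinite_finite_induct)
    (auto intro: psd_sum_kernel_add psd_sum_kernel_const)

text \<open>The exponential factor is absorbed into the vector \<open>\<xi>\<close>.\<close>
lemma psd_sum_kernel_mult_exp:
  assumes "psd_sum_kernel f" "0 \<le> c"
  shows "psd_sum_kernel (\<lambda>t. c * exp (k * t) * f t)"
  unfolding psd_sum_kernel_def
proof (intro allI)
  fix N :: nat and t :: "nat \<Rightarrow> real" and \<xi> :: "nat \<Rightarrow> complex"
  define \<eta> where "\<eta> r = complex_of_real (exp (k * t r)) * \<xi> r" for r
  have "(\<Sum>r=1..N. \<Sum>s=1..N.
           complex_of_real (c * exp (k * (t r + t s)) * f (t r + t s)) * \<xi> r * cnj (\<xi> s))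
      = complex_of_real c *
          (\<Sum>r=1..N. \<Sum>s=1..N. complex_of_real (f (t r + t s)) * \<eta> r * cnj (\<eta> s))"
    by (simp add: \<eta>_def sum_distrib_left distrib_left exp_add mult_ac)
  moreover have "(\<Sum>r=1..N. \<Sum>s=1..N. complex_of_real (f (t r + t s)) * \<eta> r * cnj (\<eta> s)) \<in> \<real>\<^sub>\<ge>\<^sub>0"
    using assms(1) unfolding psd_sum_kernel_def by blast
  ultimately show "(\<Sum>r=1..N. \<Sum>s=1..N.
      complex_of_real (c * exp (k * (t r + t s)) * f (t r + t s)) * \<xi> r * cnj (\<xi> s)) \<in> \<real>\<^sub>\<ge>\<^sub>0"
    using assms(2) by (simp only:) (intro nonneg_Reals_mult_I, simp_all)
qed

text \<open>For fixed \<open>N\<close>, \<open>t\<close> and \<open>\<xi>\<close> the form involves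
  finitely many values of the function, and the nonnegative reals are closed in the complex
  plane.\<close>

lemma psd_sum_kernel_limit:
  assumes "\<And>n. psd_sum_kernel (f n)" and "\<And>t. (\<lambda>n. f n t) \<longlonglongrightarrow> g t"
  shows "psd_sum_kernel g"
  unfolding psd_sum_kernel_def
proof (intro allI)
  fix N :: nat and t :: "nat \<Rightarrow> real" and \<xi> :: "nat \<Rightarrow> complex"
  have lim: "(\<lambda>n. \<Sum>r=1..N. \<Sum>s=1..N. complex_of_real (f n (t r + t s)) * \<xi> r * cnj (\<xi> s))
      \<longlonglongrightarrow> (\<Sum>r=1..N. \<Sum>s=1..N. complex_of_real (g (t r + t s)) * \<xi> r * cnj (\<xi> s))"
    by (intro tendsto_intros assms(2))
  have mem: "(\<Sum>r=1..N. \<Sum>s=1..N. complex_of_real (f n (t r + t s)) * \<xi> r * cnj (\<xi> s)) \<in> \<real>\<^sub>\<ge>\<^sub>0" for n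
    using assms(1) unfolding psd_sum_kernel_def by blast
  show "(\<Sum>r=1..N. \<Sum>s=1..N. complex_of_real (g (t r + t s)) * \<xi> r * cnj (\<xi> s)) \<in> \<real>\<^sub>\<ge>\<^sub>0"
    by (rule closed_sequentially[OF closed_nonneg_Reals_complex mem lim])
qed

text \<open>The matrix is a diagonal matrix of exponentials times the nonnegative matrix
  \<open>c\<close>. One more factor on the left thus turns each entry into a sum of earlier entries
  of the same column, weighted by nonnegative multiples of exponentials.\<close>

lemma psd_sum_kernel_matpow:
  fixes c :: "'n::finite \<Rightarrow> 'n \<Rightarrow> real" and k :: "'n \<Rightarrow> real"
  assumes "\<And>i j. 0 \<le> c i j"
  shows "psd_sum_kernel (\<lambda>t. matpow (\<chi> i j. c i j * exp (k i * t)) m $ i $ j)"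
proof (induction m arbitrary: i j)
  case 0
  show ?case
    by (auto simp: mat_def intro: psd_sum_kernel_const)
next
  case (Suc m)
  show ?case
    unfolding matpow.simps matrix_matrix_mult_def vec_lambda_beta
    by (intro psd_sum_kernel_sum psd_sum_kernel_mult_exp Suc.IH assms)
qed

text \<open>\<open>l\<close> and \<open>m\<close> are the eigenvalues of \<open>A\<close>; the recursion is the Cayley--Hamilton identity.\<close>
lemma trace_matpow_2:
  fixes A :: "real^2^2"
  assumes tr: "trace A = l + m" and det: "det A = l * m"
  shows "trace (matpow A n) = l ^ n + m ^ n"
proof (induction n rule: induct_nat_012)
  case 0
  show ?case by (simp add: trace_def mat_def sum_2)
next
  case 1
  show ?case using tr by simp
next
  case (ge2 n)
  have t: "A $ 1 $ 1 + A $ 2 $ 2 = l + m"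
    using tr by (simp add: trace_def sum_2)
  have d: "A $ 1 $ 1 * A $ 2 $ 2 - A $ 1 $ 2 * A $ 2 $ 1 = l * m"
    using det by (simp add: det_2)
  define B where "B = matpow A n"
  have "trace (A ** (A ** B)) = (A $ 1 $ 1 + A $ 2 $ 2) * trace (A ** B)
      - (A $ 1 $ 1 * A $ 2 $ 2 - A $ 1 $ 2 * A $ 2 $ 1) * trace B"
    by (simp add: trace_def sum_2 matrix_matrix_mult_def algebra_simps)
  also have "\<dots> = (l + m) * (l ^ Suc n + m ^ Suc n) - l * m * (l ^ n + m ^ n)"
    using ge2 by (simp add: t d B_def)
  also have "\<dots> = l ^ Suc (Suc n) + m ^ Suc (Suc n)"
    by (simp add: algebra_simps)
  finally show ?case by (simp add: B_def)
qed

text \<open>Trace is linear on a finite-dimensional space, hence continuous, and may be taken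
  termwise; the series then splits into two scalar exponential series.\<close>

lemma trace_mat_exp_2:
  fixes A :: "real^2^2"
  assumes "trace A = l + m" and "det A = l * m"
  shows "trace (mat_exp A) = exp l + exp m"
proof -
  have "linear (trace :: real^2^2 \<Rightarrow> real)"
    by (intro linearI) (simp_all add: trace_def sum.distrib sum_distrib_left)
  then have "bounded_linear (trace :: real^2^2 \<Rightarrow> real)"
    by (simp add: linear_conv_bounded_linear)
  from bounded_linear.sums[OF this summable_sums[OF summable_mat_exp]]
  have "(\<lambda>k. trace ((1 / fact k) *\<^sub>R matpow A k)) sums trace (mat_exp A)"
    unfolding mat_exp_def .
  moreover have "trace ((1 / fact k) *\<^sub>R matpow A k) = l ^ k /\<^sub>R fact k + m ^ k /\<^sub>R fact k" for k
    using trace_matpow_2[OF assms, of k]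
    by (simp add: trace_def field_simps flip: sum_divide_distrib)
  moreover have "(\<lambda>k. l ^ k /\<^sub>R fact k + m ^ k /\<^sub>R fact k) sums (exp l + exp m)"
    by (intro sums_add exp_converges)
  ultimately show ?thesis
    by (simp add: sums_unique2)
qed

text \<open>The matrix is traceless with determinant -((\<alpha> t)^2 + \<beta>^2), so its
  eigenvalues are opposite square roots.\<close>

lemma trace_exp_sigma_tau:
  "trace_exp (\<alpha> *\<^sub>R \<sigma>) (\<beta> *\<^sub>R \<tau>) t
     = exp (sqrt ((\<alpha> * t)\<^sup>2 + \<beta>\<^sup>2)) + exp (- sqrt ((\<alpha> * t)\<^sup>2 + \<beta>\<^sup>2))"
  unfolding trace_exp_def
proof (rule trace_mat_exp_2)
  have "0 \<le> (\<alpha> * t)\<^sup>2 + \<beta>\<^sup>2" by simp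
  then have "sqrt ((\<alpha> * t)\<^sup>2 + \<beta>\<^sup>2) * - sqrt ((\<alpha> * t)\<^sup>2 + \<beta>\<^sup>2) = - ((\<alpha> * t)\<^sup>2 + \<beta>\<^sup>2)"
    by simp
  then show "det (t *\<^sub>R \<alpha> *\<^sub>R \<sigma> + \<beta> *\<^sub>R \<tau>)
      = sqrt ((\<alpha> * t)\<^sup>2 + \<beta>\<^sup>2) * - sqrt ((\<alpha> * t)\<^sup>2 + \<beta>\<^sup>2)"
    by (simp only:) (simp add: det_2 \<sigma>_def \<tau>_def power2_eq_square mult_ac)
qed (simp add: trace_def sum_2 \<sigma>_def \<tau>_def)

text \<open>Caratheodory's form of the derivative of \<open>ln\<close> at 1 avoids a case distinction on \<open>a n = 1\<close>.\<close>
lemma power_tendsto_exp: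
  fixes a :: "nat \<Rightarrow> real"
  assumes w: "(\<lambda>n. real n * (a n - 1)) \<longlonglongrightarrow> w"
  shows "(\<lambda>n. a n ^ n) \<longlonglongrightarrow> exp w"
proof -
  have "(\<lambda>n. inverse (real n) * (real n * (a n - 1))) \<longlonglongrightarrow> 0 * w"
    by (intro tendsto_mult w LIMSEQ_inverse_real_of_nat[THEN LIMSEQ_imp_Suc])
  moreover have "\<forall>\<^sub>F n in sequentially. inverse (real n) * (real n * (a n - 1)) = a n - 1"
    using eventually_gt_at_top[of "0::nat"] by eventually_elim simp
  ultimately have "(\<lambda>n. a n - 1) \<longlonglongrightarrow> 0"
    by (simp add: filterlim_cong)
  then have a1: "a \<longlonglongrightarrow> 1"
    by (simp add: LIM_zero_iff)
  have "(ln has_real_derivative 1) (at (1::real))"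
    using DERIV_ln[of "1::real"] by simp
  then obtain g where g: "\<And>z::real. ln z - ln 1 = g z * (z - 1)" "isCont g 1" "g 1 = 1"
    unfolding CARAT_DERIV by blast
  have "(\<lambda>n. g (a n) * (real n * (a n - 1))) \<longlonglongrightarrow> 1 * w"
    using isCont_tendsto_compose[OF g(2) a1] g(3) by (intro tendsto_mult w) simp
  then have "(\<lambda>n. exp (g (a n) * (real n * (a n - 1)))) \<longlonglongrightarrow> exp w"
    by (intro tendsto_exp) simp
  \<comment> \<open>Early terms may be nonpositive; convergence to 1 makes \<open>a n\<close>
    eventually positive, so that \<open>exp\<close> undoes \<open>ln\<close>.\<close>
  moreover have "\<forall>\<^sub>F n in sequentially. exp (g (a n) * (real n * (a n - 1))) = a n ^ n"
    using order_tendstoD(1)[OF a1 zero_less_one]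
  proof eventually_elim
    case (elim n)
    have "g (a n) * (real n * (a n - 1)) = real n * ln (a n)"
      using g(1)[of "a n"] by simp
    then show ?case
      using elim by (simp only: exp_of_nat_mult exp_ln)
  qed
  ultimately show ?thesis
    by (rule Lim_transform_eventually)
qed

text \<open>The base is 1 + s sqrt(x^2 + y^2) / n up to o(1/n): cosh (x/n) - 1 is of order 1/n^2,
  and n sinh (x/n) tends to x.\<close>

lemma trotter_eigenvalue_limit:
  fixes x y s :: real
  shows "(\<lambda>n. (cosh (x / n) + s * sqrt ((sinh (x / n))\<^sup>2 + (y / n)\<^sup>2)) ^ n)
           \<longlonglongrightarrow> exp (s * sqrt (x\<^sup>2 + y\<^sup>2))"
proof (rule power_tendsto_exp)
  have c: "(\<lambda>n. real n * (cosh (x / n) - 1)) \<longlonglongrightarrow> 0"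
    by real_asymp
  have s: "(\<lambda>n. real n * sinh (x / n)) \<longlonglongrightarrow> x"
    by real_asymp
  have "(\<lambda>n. real n * (cosh (x / n) - 1) + s * sqrt ((real n * sinh (x / n))\<^sup>2 + y\<^sup>2))
      \<longlonglongrightarrow> 0 + s * sqrt (x\<^sup>2 + y\<^sup>2)"
    by (intro tendsto_intros c s)
  moreover have "\<forall>\<^sub>F n in sequentially.
      real n * (cosh (x / n) - 1) + s * sqrt ((real n * sinh (x / n))\<^sup>2 + y\<^sup>2)
      = real n * (cosh (x / n) + s * sqrt ((sinh (x / n))\<^sup>2 + (y / n)\<^sup>2) - 1)"
    using eventually_gt_at_top[of "0::nat"]
  proof eventually_elim
    case (elim n)
    have "(real n * sinh (x / n))\<^sup>2 + y\<^sup>2 = (real n)\<^sup>2 * ((sinh (x / n))\<^sup>2 + (y / n)\<^sup>2)"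
      using elim by (simp add: field_simps power2_eq_square)
    then have "sqrt ((real n * sinh (x / n))\<^sup>2 + y\<^sup>2)
        = real n * sqrt ((sinh (x / n))\<^sup>2 + (y / n)\<^sup>2)"
      by (simp only: real_sqrt_mult) simp
    then show ?case
      by (simp only:) (simp add: algebra_simps)
  qed
  ultimately show "(\<lambda>n. real n * (cosh (x / n) + s * sqrt ((sinh (x / n))\<^sup>2 + (y / n)\<^sup>2) - 1))
      \<longlonglongrightarrow> s * sqrt (x\<^sup>2 + y\<^sup>2)"
    by (simp add: Lim_transform_eventually)
qed

text \<open>The matrix \<open>e\<^bsup>t\<alpha>\<sigma>/n\<^esup> (1 + \<beta>\<tau>/n)\<close>.\<close>
definition trotter_factor :: "real \<Rightarrow> real \<Rightarrow> nat \<Rightarrow> real \<Rightarrow> real^2^2" where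
  "trotter_factor \<alpha> \<beta> n t =
     (\<chi> i j. (if i = j then 1 else \<beta> / n) * exp ((if i = 1 then \<alpha> / n else - (\<alpha> / n)) * t))"

text \<open>The factor has trace 2 cosh u and determinant 1 - (\<beta>/n)^2 with u = x/n; cosh^2 - 1
  = sinh^2 gives the eigenvalues. The coefficients 1 and -1 are the values of \<open>s\<close> in
  \<open>trotter_eigenvalue_limit\<close>.\<close>

lemma trace_matpow_trotter_factor:
  fixes \<alpha> \<beta> t :: real and n :: nat
  defines "x \<equiv> \<alpha> * t"
  shows "trace (matpow (trotter_factor \<alpha> \<beta> n t) m)
      = (cosh (x / n) + 1 * sqrt ((sinh (x / n))\<^sup>2 + (\<beta> / n)\<^sup>2)) ^ m
      + (cosh (x / n) + (-1) * sqrt ((sinh (x / n))\<^sup>2 + (\<beta> / n)\<^sup>2)) ^ m"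
proof (rule trace_matpow_2)
  define u where "u = x / n"
  define R where "R = (sinh u)\<^sup>2 + (\<beta> / n)\<^sup>2"
  have entries: "trotter_factor \<alpha> \<beta> n t $ 1 $ 1 = exp u"
    "trotter_factor \<alpha> \<beta> n t $ 1 $ 2 = \<beta> / n * exp u"
    "trotter_factor \<alpha> \<beta> n t $ 2 $ 1 = \<beta> / n * exp (- u)"
    "trotter_factor \<alpha> \<beta> n t $ 2 $ 2 = exp (- u)"
    by (simp_all add: trotter_factor_def u_def x_def)
  show "trace (trotter_factor \<alpha> \<beta> n t)
      = cosh (x / n) + 1 * sqrt ((sinh (x / n))\<^sup>2 + (\<beta> / n)\<^sup>2)
      + (cosh (x / n) + (-1) * sqrt ((sinh (x / n))\<^sup>2 + (\<beta> / n)\<^sup>2))"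
    by (simp add: trace_def sum_2 entries cosh_def flip: u_def)
  have "det (trotter_factor \<alpha> \<beta> n t) = 1 - (\<beta> / n)\<^sup>2"
    by (simp add: det_2 entries power2_eq_square exp_minus)
  also have "\<dots> = (cosh u)\<^sup>2 - R"
    by (simp add: R_def cosh_square_eq)
  also have "\<dots> = (cosh u + 1 * sqrt R) * (cosh u + (-1) * sqrt R)"
    by (simp add: R_def algebra_simps power2_eq_square)
  finally show "det (trotter_factor \<alpha> \<beta> n t)
      = (cosh (x / n) + 1 * sqrt ((sinh (x / n))\<^sup>2 + (\<beta> / n)\<^sup>2))
      * (cosh (x / n) + (-1) * sqrt ((sinh (x / n))\<^sup>2 + (\<beta> / n)\<^sup>2))"
    by (simp only: R_def u_def)
qed

theorem theorem4p1:
  fixes \<alpha> \<beta> :: real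
  assumes "\<alpha> \<ge> 0" and "\<beta> \<ge> 0"
  shows "exponentially_convex (trace_exp (\<alpha> *\<^sub>R \<sigma>) (\<beta> *\<^sub>R \<tau>))"
proof -
  let ?f = "trace_exp (\<alpha> *\<^sub>R \<sigma>) (\<beta> *\<^sub>R \<tau>)"
  have "psd_sum_kernel ?f"
  proof (rule psd_sum_kernel_limit)
    fix n
    \<comment> \<open>The coefficients 1 and \<beta>/n are nonnegative for every n, including n = 0,
      where the quotient is 0.\<close>
    show "psd_sum_kernel (\<lambda>t. trace (matpow (trotter_factor \<alpha> \<beta> n t) n))"
      unfolding trace_def trotter_factor_def
      using assms(2) by (intro psd_sum_kernel_sum psd_sum_kernel_matpow) simp
  next
    fix t
    show "(\<lambda>n. trace (matpow (trotter_factor \<alpha> \<beta> n t) n)) \<longlonglongrightarrow> ?f t"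
      unfolding trace_matpow_trotter_factor
      using tendsto_add[OF trotter_eigenvalue_limit[of "\<alpha> * t" 1 \<beta>]
          trotter_eigenvalue_limit[of "\<alpha> * t" "-1" \<beta>]]
      by (simp add: trace_exp_sigma_tau)
  qed
  \<comment> \<open>Continuity and nonnegativity are read off the closed form instead of the
    limit.\<close>
  moreover have "?f = (\<lambda>t. exp (sqrt ((\<alpha> * t)\<^sup>2 + \<beta>\<^sup>2)) + exp (- sqrt ((\<alpha> * t)\<^sup>2 + \<beta>\<^sup>2)))"
    by (simp add: fun_eq_iff trace_exp_sigma_tau)
  then have "continuous_on UNIV ?f" and "\<forall>t. 0 \<le> ?f t"
    by (auto intro!: continuous_intros add_nonneg_nonneg)
  ultimately show ?thesis
    by (simp add: exponentially_convex_def psd_sum_kernel_def)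
qed

end
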